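(* Let $q\ge 3$ be odd. The parity coefficient of a periodic sequence $PS_q^p(x_0)=\{x_j\}_{j=0}^{p-1}$ of $F_q$ is $$\mu_p=\frac1p\sum_{j=0}^{p-1}\log_q\left(\frac{2x_j}{x_j+1}\right),$$ and it fulfills the bounds $$\frac{\ln((2q-1)/q)}{\ln q}\le\log_q\left(\frac{2x_m}{x_m+1}\right)<\mu_p<\log_q\left(\frac{2x_M}{x_M+1}\right)<\log_q 2=\frac{\ln 2}{\ln q},$$ where $x_m=\inf\{x_j : 0\le j\le p-1\}$ and $x_M=\sup\{x_j: 0\le j\le p-1\}$. Therefore, if $F_q$ has a cycle with parity coefficient $\mu_p$, then $$0<2-q^{\mu_p}<\frac1q .$$
   Context: $\mathbb Z^+$ is the set of positive integers. For odd $q\ge 3$ let $X_q(n)=2(q-1)n+1$ for $n\in\mathbb Z^+$, and let $\mathbb Z_{cq}=X_q(\mathbb Z^+)=\{x\in\mathbb Z^+ : x\equiv 1 \bmod 2(q-1),\ x>1\}$. For $x\in\mathbb Z_{cq}$ let $\alpha_q(x)=1$ if $x-1\equiv 2(q-1) \pmod{4(q-1)}$ and $\alpha_q(x)=0$ if $x-1\equiv 0\pmod{4(q-1)}$, and define $F_q:\mathbb Z_{cq}\to\mathbb Z_{cq}$ by $F_q(x)=\frac{q^{\alpha_q(x)}}{2}(x+1)$. A periodic sequence (cycle) $PS_q^p(x_0)$ of $F_q$ of period $p\in\mathbb Z^+$ is a sequence $\{x_0,x_1,\ldots,x_{p-1}\}$ in $\mathbb Z_{cq}$ with $x_j=F_q^j(x_0)$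 and $x_{j+p}=x_j$, where $p$ is the minimum possible period and the seed $x_0$ is, by convention, the minimum element of the cycle. Its parity coefficient is $\mu_p=\frac1p\sum_{j=0}^{p-1}\alpha_q(x_j)$. *)

theory Defs
  imports Complex_Main "HOL-Number_Theory.Cong"
begin

definition X :: "nat \<Rightarrow> nat \<Rightarrow> nat" where
  "X q n = 2 * (q - 1) * n + 1"

definition Zc :: "nat \<Rightarrow> nat set" where
  "Zc q = X q ` {n. 0 < n}"

text \<open>
  On \<^term>\<open>Zc q\<close> the only other case is \<open>x - 1\<close> congruent to 0 modulo \<open>4 * (q - 1)\<close>;
  see \<open>Zc_cases\<close> and \<open>alpha_eq_0\<close>.
\<close>

definition alpha :: "nat \<Rightarrow> nat \<Rightarrow> nat" where
  "alpha q x = (if [x - 1 = 2 * (q - 1)] (mod (4 * (q - 1))) then 1 else 0)"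

text \<open>
  The division is exact on \<^term>\<open>Zc q\<close>, whose elements are odd; see \<open>real_F\<close>.
\<close>

definition F :: "nat \<Rightarrow> nat \<Rightarrow> nat" where
  "F q x = q ^ alpha q x * ((x + 1) div 2)"

definition periodic_sequence :: "nat \<Rightarrow> nat \<Rightarrow> (nat \<Rightarrow> nat) \<Rightarrow> bool" where
  "periodic_sequence q p x \<longleftrightarrow>
     0 < p \<and>
     (\<forall>j. x j \<in> Zc q) \<and>
     (\<forall>j. x j = (F q ^^ j) (x 0)) \<and>
     (\<forall>j. x (j + p) = x j) \<and>
     (\<forall>r. 0 < r \<and> (\<forall>j. x (j + r) = x j) \<longrightarrow> p \<le> r) \<and>
     (\<forall>j<p. x 0 \<le> x j)"

definition parity_coeff :: "nat \<Rightarrow> nat \<Rightarrow> (nat \<Rightarrow> nat) \<Rightarrow> real" where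
  "parity_coeff q p x = 1 / real p * (\<Sum>j<p. real (alpha q (x j)))"

lemma Zc_eq:
  assumes "3 \<le> q"
  shows "Zc q = {x. [x = 1] (mod (2 * (q - 1))) \<and> 1 < x}"
proof (intro set_eqI iffI)
  fix x assume "x \<in> Zc q"
  then obtain n where "0 < n" "x = 2 * (q - 1) * n + 1" by (auto simp: Zc_def X_def)
  moreover have "[2 * (q - 1) * n + 1 = 1] (mod (2 * (q - 1)))"
    by (simp only: cong_add_rcancel_0_nat cong_mult_self_left)
  ultimately show "x \<in> {x. [x = 1] (mod (2 * (q - 1))) \<and> 1 < x}" using assms by simp
next
  fix x assume "x \<in> {x. [x = 1] (mod (2 * (q - 1))) \<and> 1 < x}"
  then have c: "[x = 1] (mod (2 * (q - 1)))" and g: "1 < x" by auto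
  from c g have "2 * (q - 1) dvd x - 1"
    by (metis cong_altdef_nat less_imp_le)
  then obtain n where n: "x - 1 = 2 * (q - 1) * n" by (auto elim: dvdE)
  with g have "0 < n" "x = 2 * (q - 1) * n + 1" by (auto intro: Nat.gr0I)
  then show "x \<in> Zc q" by (auto simp: Zc_def X_def)
qed

lemma Zc_cases:
  assumes "x \<in> Zc q"
  shows "[x - 1 = 2 * (q - 1)] (mod (4 * (q - 1))) \<or> [x - 1 = 0] (mod (4 * (q - 1)))"
proof -
  from assms obtain n where n: "x = 2 * (q - 1) * n + 1" by (auto simp: Zc_def X_def)
  show ?thesis
  proof (cases "even n")
    case True
    then obtain k where "n = 2 * k" by (auto elim: evenE)
    with n have "x - 1 = 4 * (q - 1) * k" by simp
    then show ?thesis by (simp add: cong_def)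
  next
    case False
    then obtain k where "n = 2 * k + 1" by (auto elim: oddE)
    moreover have "2 * d * (2 * k + 1) = 4 * d * k + 2 * d" for d :: nat
      by (simp add: algebra_simps)
    ultimately have "x - 1 = 4 * (q - 1) * k + 2 * (q - 1)"
      using n by (simp only: add_diff_cancel_right')
    then show ?thesis by (simp add: cong_def)
  qed
qed

lemma alpha_eq_0:
  assumes "3 \<le> q" "[x - 1 = 0] (mod (4 * (q - 1)))"
  shows "alpha q x = 0"
  using assms by (auto simp: alpha_def cong_def)

lemma real_F:
  assumes "x \<in> Zc q"
  shows "real (F q x) = real q ^ alpha q x / 2 * (real x + 1)"
proof -
  from assms have "even (x + 1)" by (auto simp: Zc_def X_def)
  then have "real ((x + 1) div 2) = (real x + 1) / 2"
    by (simp only: real_of_nat_div of_nat_add of_nat_1 of_nat_numeral)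
  then show ?thesis by (simp add: F_def)
qed

lemma F_in_Zc:
  assumes "odd q" "3 \<le> q" "x \<in> Zc q"
  shows "F q x \<in> Zc q"
proof -
  from assms obtain n where n: "0 < n" "x = 2 * (q - 1) * n + 1" by (auto simp: Zc_def X_def)
  have h: "(x + 1) div 2 = (q - 1) * n + 1" using n by simp
  show ?thesis
  proof (cases "even n")
    case True
    then obtain k where k: "n = 2 * k" by (auto elim: evenE)
    with n have "x - 1 = 4 * (q - 1) * k" by simp
    then have "alpha q x = 0" by (intro alpha_eq_0 assms) (simp add: cong_def)
    then have "F q x = X q k" using h k by (simp add: F_def X_def)
    moreover have "0 < k" using n k by simp
    ultimately show ?thesis by (simp add: Zc_def)
  next
    case False
    then obtain k where "n = 2 * k + 1" by (auto elim: oddE)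
    moreover have "2 * d * (2 * k + 1) = 4 * d * k + 2 * d" for d :: nat
      by (simp add: algebra_simps)
    ultimately have "x - 1 = 4 * (q - 1) * k + 2 * (q - 1)"
      using n by (simp only: add_diff_cancel_right')
    then have a: "alpha q x = 1" by (simp add: alpha_def cong_def)
    from False assms have "even (q * n + 1)" by simp
    then obtain m where m: "q * n + 1 = 2 * m" by (rule evenE)
    have "F q x = q * ((q - 1) * n + 1)" using a h by (simp add: F_def)
    also have "\<dots> = (q - 1) * (q * n + 1) + 1"
    proof -
      have "q = (q - 1) + 1" using assms by simp
      then obtain d where "q = d + 1" by blast
      then show ?thesis by (simp add: algebra_simps)
    qed
    also have "\<dots> = X q m" using m by (simp add: X_def)
    finally have "F q x = X q m" .
    moreover have "0 < m" using m by (auto intro: Nat.gr0I)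
    ultimately show ?thesis by (simp add: Zc_def)
  qed
qed

end

theory Submission imports Defs begin

text \<open>
  Solving \<open>F q x = q ^ alpha q x * (x + 1) / 2\<close> for the exponent gives
  \<open>alpha q x = log\<^sub>q (2 * F q x / (x + 1))\<close>. Along a cycle every element is the successor of
  exactly one element, so in the sum of these logarithms the numerators \<open>x\<^sub>j\<^sub>+\<^sub>1\<close> can be
  replaced by \<open>x\<^sub>j\<close>: this is the formula for \<open>\<mu>\<close> (\<open>sum_alpha_cycle\<close>), and it exhibits \<open>\<mu>\<close>
  as the mean of the values \<open>g (x\<^sub>j)\<close>, where \<open>g t = log\<^sub>q (2 * t / (t + 1))\<close>.

  The function \<open>g\<close> is strictly increasing and stays below \<open>log\<^sub>q 2\<close>, so the mean lies between
  \<open>g x\<^sub>m\<close> and \<open>g x\<^sub>M\<close>. Both inequalities are strict because \<open>F q\<close> has no fixed point in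
  \<^term>\<open>Zc q\<close> (\<open>F_no_fixed_point\<close>), whence a cycle is never constant. The smallest element of
  \<^term>\<open>Zc q\<close> is \<open>2 * q - 1\<close>, and \<open>g (2 * q - 1) = log\<^sub>q ((2 * q - 1) / q)\<close>; this yields
  \<open>2 - 1 / q < q powr \<mu> < 2\<close>.
\<close>

lemma Zc_ge:
  assumes "3 \<le> q" "x \<in> Zc q"
  shows "2 * q - 1 \<le> x"
proof -
  from assms obtain n where n: "0 < n" "x = 2 * (q - 1) * n + 1" by (auto simp: Zc_def X_def)
  have "2 * (q - 1) * 1 \<le> 2 * (q - 1) * n" using n by (intro mult_le_mono2) simp
  then show ?thesis using n(2) assms(1) by linarith
qed

text \<open>
  The map either shrinks its argument, to \<open>(x + 1) / 2\<close>, or expands it, to at least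
  \<open>3 * (x + 1) / 2\<close>.
\<close>

lemma F_no_fixed_point:
  assumes "3 \<le> q" "x \<in> Zc q"
  shows "F q x \<noteq> x"
proof
  assume fixed: "F q x = x"
  have x: "1 < x" using Zc_ge[OF assms] assms by simp
  have eq: "real x = real q ^ alpha q x / 2 * (real x + 1)"
    using real_F[OF assms(2)] fixed by simp
  show False
  proof (cases "alpha q x = 0")
    case True
    then show False using eq x by simp
  next
    case False
    then have "alpha q x = 1"
      by (simp add: alpha_def split: if_splits)
    have "3 * (real x + 1) \<le> real q * (real x + 1)"
      using assms by (intro mult_right_mono) simp_all
    also have "\<dots> = 2 * real x" using eq \<open>alpha q x = 1\<close> by simp
    finally show False by simp
  qed
qed

text \<open>The recursion \<open>F\<close>, read as an equation for the exponent of \<open>q\<close>.\<close>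

lemma alpha_eq_log:
  assumes "3 \<le> q" "x \<in> Zc q"
  shows "real (alpha q x) = log q (2 * real (F q x) / (real x + 1))"
proof -
  have "2 * real (F q x) / (real x + 1) = real q ^ alpha q x"
    using real_F[OF assms(2)] by (simp add: field_simps)
  then show ?thesis using assms by simp
qed

lemma periodic_sequence_Suc:
  assumes "periodic_sequence q p x"
  shows "x (Suc j) = F q (x j)"
proof -
  have "\<forall>j. x j = (F q ^^ j) (x 0)" using assms unfolding periodic_sequence_def by blast
  then have "x (Suc j) = (F q ^^ Suc j) (x 0)" "x j = (F q ^^ j) (x 0)" by blast+
  then show ?thesis by (metis comp_apply funpow.simps(2))
qed

text \<open>
  A one-step shift does not change a sum over a full period, so the logarithms of the numerators
  may be shifted back by one index.
\<close>

lemma sum_alpha_cycle: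
  assumes "3 \<le> q" "periodic_sequence q p x"
  shows "(\<Sum>j<p. real (alpha q (x j))) = (\<Sum>j<p. log q (2 * real (x j) / (real (x j) + 1)))"
proof -
  have Zc: "x j \<in> Zc q" for j using assms(2) unfolding periodic_sequence_def by blast
  have pos: "0 < x j" for j using Zc_ge[OF assms(1) Zc[of j]] assms(1) by simp
  have split: "log q (2 * real (x i) / (real (x j) + 1))
      = log q (x i) + log q (2 / (real (x j) + 1))" for i j
  proof -
    have "2 * real (x i) / (real (x j) + 1) = real (x i) * (2 / (real (x j) + 1))" by simp
    also have "log q \<dots> = log q (x i) + log q (2 / (real (x j) + 1))"
      using pos[of i] assms(1) by (subst log_mult) simp_all
    finally show ?thesis .
  qed
  have "x (0 + p) = x 0" using assms(2) unfolding periodic_sequence_def by blast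
  then have "x p = x 0" by simp
  then have shift: "(\<Sum>j<p. log q (x (Suc j))) = (\<Sum>j<p. log q (x j))"
    using sum_lessThan_telescope[of "\<lambda>j. log q (x j)" p] by (simp add: sum_subtractf)
  have "(\<Sum>j<p. real (alpha q (x j))) = (\<Sum>j<p. log q (2 * real (x (Suc j)) / (real (x j) + 1)))"
    using alpha_eq_log[OF assms(1) Zc] periodic_sequence_Suc[OF assms(2)] by simp
  also have "\<dots> = (\<Sum>j<p. log q (2 * real (x j) / (real (x j) + 1)))"
    unfolding split sum.distrib shift ..
  finally show ?thesis .
qed

lemma mean_greater:
  fixes f :: "nat \<Rightarrow> real"
  assumes "\<And>j. j < p \<Longrightarrow> c \<le> f j" "i < p" "c < f i"
  shows "c < 1 / real p * (\<Sum>j<p. f j)"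
proof -
  have "(\<Sum>j<p. c) < (\<Sum>j<p. f j)"
    using assms by (intro sum_strict_mono_ex1) auto
  then show ?thesis using assms(2) by (simp add: field_simps)
qed

lemma mean_less:
  fixes f :: "nat \<Rightarrow> real"
  assumes "\<And>j. j < p \<Longrightarrow> f j \<le> c" "i < p" "f i < c"
  shows "1 / real p * (\<Sum>j<p. f j) < c"
  using mean_greater[of p "- c" "\<lambda>j. - f j" i] assms by (simp add: sum_negf)

text \<open>The argument of the logarithm is \<open>2 - 2 / (t + 1)\<close>, which increases with \<open>t\<close>.\<close>

lemma log_double_div_Suc_strict_mono:
  fixes b s t :: real
  assumes "1 < b" "0 < s" "s < t"
  shows "log b (2 * s / (s + 1)) < log b (2 * t / (t + 1))"
proof -
  have "2 * s / (s + 1) < 2 * t / (t + 1)" using assms by (simp add: field_simps)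
  then show ?thesis using assms by simp
qed

theorem lemma10:
  fixes q p x_m x_M :: nat and x :: "nat \<Rightarrow> nat" and \<mu> :: real
  assumes "odd q" and "3 \<le> q"
    and "periodic_sequence q p x"
    and "\<mu> = parity_coeff q p x"
    and "x_m = (INF j\<in>{..<p}. x j)"
    and "x_M = (SUP j\<in>{..<p}. x j)"
  shows "\<mu> = 1 / real p * (\<Sum>j<p. log (real q) (2 * real (x j) / (real (x j) + 1)))
    \<and> ln ((2 * real q - 1) / real q) / ln (real q) \<le> log (real q) (2 * real x_m / (real x_m + 1))
    \<and> log (real q) (2 * real x_m / (real x_m + 1)) < \<mu>
    \<and> \<mu> < log (real q) (2 * real x_M / (real x_M + 1))
    \<and> log (real q) (2 * real x_M / (real x_M + 1)) < log (real q) 2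
    \<and> log (real q) 2 = ln 2 / ln (real q)
    \<and> 0 < 2 - real q powr \<mu>
    \<and> 2 - real q powr \<mu> < 1 / real q"
proof -
  define g where "g n = log q (2 * real n / (real n + 1))" for n :: nat
  have q: "1 < real q" using assms(2) by simp
  have p: "0 < p" and Zc: "x j \<in> Zc q" and per: "x (j + p) = x j" for j
    using assms(3) unfolding periodic_sequence_def by blast+
  have ge: "2 * q - 1 \<le> x j" for j using Zc_ge[OF assms(2) Zc] .
  have g_less: "g m < g n" if "0 < m" "m < n" for m n
    using log_double_div_Suc_strict_mono[OF q] that by (simp add: g_def)
  have g_le: "g m \<le> g n" if "0 < m" "m \<le> n" for m n
    using g_less[of m n] that by (cases "m = n") auto

  have \<mu>: "\<mu> = 1 / real p * (\<Sum>j<p. g (x j))"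
    using sum_alpha_cycle[OF assms(2,3)] assms(4) by (simp add: parity_coeff_def g_def)

  have "x 1 \<noteq> x 0"
    using F_no_fixed_point[OF assms(2) Zc] periodic_sequence_Suc[OF assms(3), of 0] by simp
  moreover from this have "1 < p" using p per[of 0] by (cases "p = 1") auto
  ultimately have ne: "\<exists>i<p. x i \<noteq> c" for c using p by metis

  have ms: "x_m \<in> x ` {..<p}"
    unfolding assms(5) using p by (intro Inf_nat_def1) auto
  then obtain k where k: "x_m = x k" by auto
  have m_le: "x_m \<le> x j" if "j < p" for j
    unfolding assms(5) using that by (intro cINF_lower) auto
  have le_M: "x j \<le> x_M" if "j < p" for j
    unfolding assms(6) using that by (intro cSUP_upper) auto
  have m_ge: "2 * q - 1 \<le> x_m" using k ge by simp
  then have m_pos: "0 < x_m" using assms(2) by simp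
  have M_pos: "0 < x_M" using m_pos m_le[OF p] le_M[OF p] by simp

  have lower: "g x_m < \<mu>"
  proof -
    obtain i where i: "i < p" "x i \<noteq> x_m" using ne by blast
    then have "x_m < x i" using m_le[of i] by simp
    then show ?thesis unfolding \<mu> using i m_le m_pos
      by (intro mean_greater[of _ _ _ i] g_le g_less)
  qed
  have upper: "\<mu> < g x_M"
  proof -
    obtain i where i: "i < p" "x i \<noteq> x_M" using ne by blast
    then have "x i < x_M" using le_M[of i] by simp
    moreover have "0 < x j" for j using ge[of j] assms(2) by simp
    ultimately show ?thesis unfolding \<mu> using i le_M
      by (intro mean_less[of _ _ _ i] g_le g_less)
  qed
  have g_M: "g x_M < log q 2"
  proof -
    have "2 * real x_M / (real x_M + 1) < 2" by (simp add: field_simps)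
    then show ?thesis unfolding g_def using q M_pos by simp
  qed
  have least: "log q ((2 * real q - 1) / real q) \<le> g x_m"
  proof -
    have "log q ((2 * real q - 1) / real q) = g (2 * q - 1)"
    proof -
      have "2 * real (2 * q - 1) / (real (2 * q - 1) + 1) = (2 * real q - 1) / real q"
        using assms(2) by (simp add: of_nat_diff field_simps)
      then show ?thesis by (simp add: g_def)
    qed
    also have "\<dots> \<le> g x_m" using m_ge assms(2) by (intro g_le) simp_all
    finally show ?thesis .
  qed

  have "real q powr \<mu> < 2"
    using upper g_M q by (simp add: powr_less_iff)
  moreover have "(2 * real q - 1) / real q < real q powr \<mu>"
    using lower least q by (subst less_powr_iff) simp_all
  then have "2 - 1 / real q < real q powr \<mu>"
    using q by (simp add: diff_divide_distrib)
  ultimately show ?thesis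
    using \<mu> lower upper g_M least by (simp add: g_def log_def)
qed

end
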